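(* Let $H\in(0,1)$ and $K\in(0,1)$. Let $B^{H,K}$ be a bifractional Brownian motion with parameters $H,K$ and let $B^{HK}$ be a fractional Brownian motion with Hurst index $HK$. Then, as $h\to\infty$, the processes $$\left(B^{H,K}_{h+t}-B^{H,K}_h,\ t\ge 0\right)$$ converge, in the sense of convergence of all finite dimensional distributions, to the process $$\left(2^{(1-K)/2}B^{HK}_t,\ t\ge 0\right).$$
   Context: For $H\in(0,1)$, $K\in(0,1]$, the bifractional Brownian motion $B^{H,K}=(B^{H,K}_t,\ t\ge0)$ is the centered Gaussian process with covariance $E[B^{H,K}_tB^{H,K}_s]=2^{-K}\left((t^{2H}+s^{2H})^K-|t-s|^{2HK}\right)$. For $G\in(0,1)$, the fractional Brownian motion $B^{G}=(B^G_t,\ t\ge 0)$ with Hurst index $G$ is the centered Gaussian process with covariance $E[B^G_tB^G_s]=\frac12\left(t^{2G}+s^{2G}-|t-s|^{2G}\right)$; here it is used with $G=HK$. *)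

theory Defs
  imports "HOL-Probability.Probability"
begin

(* The case s = 0 is the point mass at m: normal_density m 0 is not a probability density. *)
definition gaussian_rv :: "'a measure \<Rightarrow> ('a \<Rightarrow> real) \<Rightarrow> bool" where
  "gaussian_rv M Y \<longleftrightarrow> Y \<in> borel_measurable M \<and>
     (\<exists>m s. 0 \<le> s \<and>
        distr M borel Y =
          (if s = 0 then return borel m
           else density lborel (\<lambda>x. ennreal (normal_density m s x))))"

(* Processes are total functions of the index; only indices in I are constrained. *)
definition gaussian_process_on ::
    "'i set \<Rightarrow> 'a measure \<Rightarrow> ('i \<Rightarrow> 'a \<Rightarrow> real) \<Rightarrow> bool" where
  "gaussian_process_on I M X \<longleftrightarrow> prob_space M \<and>
     (\<forall>t\<in>I. X t \<in> borel_measurable M) \<and>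
     (\<forall>T a. finite T \<longrightarrow> T \<subseteq> I \<longrightarrow> gaussian_rv M (\<lambda>\<omega>. \<Sum>t\<in>T. a t * X t \<omega>))"

definition centered_gaussian_process_on ::
    "'i set \<Rightarrow> ('i \<Rightarrow> 'i \<Rightarrow> real) \<Rightarrow> 'a measure \<Rightarrow> ('i \<Rightarrow> 'a \<Rightarrow> real) \<Rightarrow> bool" where
  "centered_gaussian_process_on I R M X \<longleftrightarrow> gaussian_process_on I M X \<and>
     (\<forall>t\<in>I. prob_space.expectation M (X t) = 0) \<and>
     (\<forall>t\<in>I. \<forall>s\<in>I. prob_space.expectation M (\<lambda>\<omega>. X t \<omega> * X s \<omega>) = R t s)"

definition bifractional_brownian_motion ::
    "real \<Rightarrow> real \<Rightarrow> 'a measure \<Rightarrow> (real \<Rightarrow> 'a \<Rightarrow> real) \<Rightarrow> bool" where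
  "bifractional_brownian_motion H K = centered_gaussian_process_on {0..}
     (\<lambda>t s. 2 powr (-K) *
        ((t powr (2 * H) + s powr (2 * H)) powr K - \<bar>t - s\<bar> powr (2 * H * K)))"

definition fractional_brownian_motion ::
    "real \<Rightarrow> 'a measure \<Rightarrow> (real \<Rightarrow> 'a \<Rightarrow> real) \<Rightarrow> bool" where
  "fractional_brownian_motion G = centered_gaussian_process_on {0..}
     (\<lambda>t s. 1 / 2 * (t powr (2 * G) + s powr (2 * G) - \<bar>t - s\<bar> powr (2 * G)))"

(* Weak convergence of Borel measures on an arbitrary topological space; the library's
   weak_conv_m covers only sequences of measures on the real line. *)
definition weakly_convergent_on ::
    "'b topology \<Rightarrow> ('h \<Rightarrow> 'b measure) \<Rightarrow> 'b measure \<Rightarrow> 'h filter \<Rightarrow> bool" where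
  "weakly_convergent_on S \<mu> \<nu> F \<longleftrightarrow>
     (\<forall>f. continuous_map S euclideanreal f \<longrightarrow> bounded (f ` topspace S) \<longrightarrow>
        ((\<lambda>h. \<integral>x. f x \<partial>\<mu> h) \<longlongrightarrow> (\<integral>x. f x \<partial>\<nu>)) F)"

(* Law of (X (t 0), ..., X (t (n - 1))), with n-dimensional Euclidean space represented by
   the extensional functions on {..<n}. *)
definition fin_dim_distr ::
    "'a measure \<Rightarrow> ('i \<Rightarrow> 'a \<Rightarrow> real) \<Rightarrow> nat \<Rightarrow> (nat \<Rightarrow> 'i) \<Rightarrow> (nat \<Rightarrow> real) measure" where
  "fin_dim_distr M X n t =
     distr M (Pi\<^sub>M {..<n} (\<lambda>_. borel)) (\<lambda>\<omega>. \<lambda>i\<in>{..<n}. X (t i) \<omega>)"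

definition fdd_convergent_on ::
    "'i set \<Rightarrow> 'a measure \<Rightarrow> ('h \<Rightarrow> 'i \<Rightarrow> 'a \<Rightarrow> real) \<Rightarrow>
     'b measure \<Rightarrow> ('i \<Rightarrow> 'b \<Rightarrow> real) \<Rightarrow> 'h filter \<Rightarrow> bool" where
  "fdd_convergent_on I M X N Y F \<longleftrightarrow>
     (\<forall>n t. (\<forall>i<n. t i \<in> I) \<longrightarrow>
        weakly_convergent_on (product_topology (\<lambda>_. euclideanreal) {..<n})
          (\<lambda>h. fin_dim_distr M (X h) n t) (fin_dim_distr N Y n t) F)"

(* The test functions above are Borel, so the integrals defining fdd convergence are
   genuine expectations. *)
lemma borel_measurable_continuous_map_PiM:
  fixes f :: "(nat \<Rightarrow> real) \<Rightarrow> real"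
  assumes "continuous_map (product_topology (\<lambda>_. euclideanreal) {..<n}) euclideanreal f"
  shows "f \<in> borel_measurable (Pi\<^sub>M {..<n} (\<lambda>_. borel))"
proof -
  let ?r = "\<lambda>x::nat \<Rightarrow> real. restrict x {..<n}"
  let ?e = "\<lambda>(x::nat \<Rightarrow> real) i. if i < n then x i else 0"
  have "continuous_map (product_topology (\<lambda>_. euclideanreal) UNIV)
          (product_topology (\<lambda>_. euclideanreal) {..<n}) ?r"
    by (auto simp: continuous_map_componentwise intro: continuous_map_product_projection)
  from continuous_map_compose[OF this assms]
  have "continuous_on UNIV (f \<circ> ?r)"
    by (simp add: euclidean_product_topology)
  then have 1: "f \<circ> ?r \<in> borel_measurable borel"
    by (rule borel_measurable_continuous_onI)
  have "?e \<in> measurable (Pi\<^sub>M {..<n} (\<lambda>_. borel)) (Pi\<^sub>M UNIV (\<lambda>_. borel))"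
  proof (rule measurable_PiM_single')
    show "(\<lambda>x. ?e x i) \<in> borel_measurable (Pi\<^sub>M {..<n} (\<lambda>_. borel))" for i
      by (cases "i < n") (auto intro: measurable_component_singleton)
  qed auto
  then have "?e \<in> measurable (Pi\<^sub>M {..<n} (\<lambda>_. borel)) borel"
    by (simp cong: measurable_cong_sets add: sets_PiM_equal_borel)
  from measurable_compose[OF this 1]
  have "(\<lambda>x. f (?r (?e x))) \<in> borel_measurable (Pi\<^sub>M {..<n} (\<lambda>_. borel))"
    by simp
  moreover have "f (?r (?e x)) = f x" if "x \<in> space (Pi\<^sub>M {..<n} (\<lambda>_. borel))" for x
    using that by (intro arg_cong[of _ _ f]) (auto simp: space_PiM PiE_def extensional_def fun_eq_iff)
  ultimately show ?thesis
    by (subst measurable_cong[symmetric]) auto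
qed

end

(* A centered Gaussian vector X satisfies E cos (a . X + b) = cos b * exp (- Var (a . X) / 2), so
   convergence of covariances gives convergence of the expectations of all trigonometric
   polynomials. Stone-Weierstrass on a large cube together with a bound on second moments extends
   this to all bounded continuous test functions. The increments of the bifractional Brownian
   motion have the covariance of the limit plus a mixed second difference of
   (x, y) |-> (x^(2H) + y^(2H))^K at (h, h), which is O(h^(2HK-2)) by applying the mean value
   theorem in each variable. *)
theory Submission imports Defs begin

subsection \<open>Trigonometric polynomials and weak convergence\<close>

text \<open>The cube has to be fixed before the approximating polynomial, because the polynomial
  depends on it. The error outside the cube is then controllable only if a global bound on the
  polynomial is known in advance; an arbitrary Stone-Weierstrass approximant has none that is
  independent of the cube. This is why the approximation takes place inside an algebra of periodic
  functions whose values are all attained on the cube. On the covariance side, each of the four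
  terms of the second difference grows like h^(2HK), so the limit cannot be taken term by term; only
  the mixed derivative has the decaying order 2HK - 2, which is negative since HK < 1. What survives
  of the covariance is 2^(-K) (t^(2HK) + s^(2HK) - |t - s|^(2HK)), that is, 2^(1-K) times the
  fractional Brownian covariance, whence the factor 2^((1-K)/2).\<close>

text \<open>The phase \<open>b\<close> yields sines and constants from the same generator. Products
  are derived instead of being a constructor, so that linearity of the integral alone reduces every
  statement about limits of expectations to single cosines.\<close>

inductive_set trig_poly :: "nat \<Rightarrow> ((nat \<Rightarrow> real) \<Rightarrow> real) set" for n where
  cos: "(\<lambda>x. cos ((\<Sum>i<n. a i * x i) + b)) \<in> trig_poly n"
| scale: "p \<in> trig_poly n \<Longrightarrow> (\<lambda>x. c * p x) \<in> trig_poly n"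
| add: "p \<in> trig_poly n \<Longrightarrow> q \<in> trig_poly n \<Longrightarrow> (\<lambda>x. p x + q x) \<in> trig_poly n"

text \<open>The product-to-sum formula rewrites a product of two generators as half the sum of the
  generators with subtracted and added frequencies and phases.\<close>

lemma trig_poly_mult_cos:
  assumes "p \<in> trig_poly n"
  shows "(\<lambda>x. cos ((\<Sum>i<n. a i * x i) + b) * p x) \<in> trig_poly n"
  using assms
proof induction
  case (cos a' b')
  have "(\<lambda>x. cos ((\<Sum>i<n. a i * x i) + b) * cos ((\<Sum>i<n. a' i * x i) + b')) =
     (\<lambda>x. 1/2 * (cos ((\<Sum>i<n. (a i - a' i) * x i) + (b - b')) + cos ((\<Sum>i<n. (a i + a' i) * x i) + (b + b'))))"
    by (simp add: cos_times_cos sum.distrib sum_subtractf add_divide_distrib algebra_simps)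
  also have "\<dots> \<in> trig_poly n"
    by (intro trig_poly.intros)
  finally show ?case .
next
  case (scale p c)
  from trig_poly.scale[OF this(2), of c] show ?case
    by (simp add: mult.left_commute)
next
  case (add p q)
  from trig_poly.add[OF this(3,4)] show ?case
    by (simp add: ring_distribs)
qed

lemma trig_poly_mult:
  assumes "p \<in> trig_poly n" "q \<in> trig_poly n"
  shows "(\<lambda>x. p x * q x) \<in> trig_poly n"
  using assms(1)
proof induction
  case (cos a b)
  then show ?case by (rule trig_poly_mult_cos[OF assms(2)])
next
  case (scale p c)
  from trig_poly.scale[OF this(2), of c] show ?case
    by (simp add: mult.assoc)
next
  case (add p r)
  from trig_poly.add[OF this(3,4)] show ?case
    by (simp add: ring_distribs)
qed

lemma trig_poly_const: "(\<lambda>_. c) \<in> trig_poly n"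
  using trig_poly.scale[OF trig_poly.cos[where n = n and a = "\<lambda>_. 0" and b = 0], of c] by simp

lemma trig_poly_sin_component:
  assumes "i < n"
  shows "(\<lambda>x. sin (c * x i)) \<in> trig_poly n"
proof -
  have "(\<lambda>x. cos ((\<Sum>j<n. (if j = i then c else 0) * x j) + (- pi / 2))) \<in> trig_poly n"
    by (rule trig_poly.cos)
  moreover have "(\<Sum>j<n. (if j = i then c else 0) * x j) = c * x i" for x :: "nat \<Rightarrow> real"
    using assms by (simp add: if_distrib[of "\<lambda>u. u * _"] cong: if_cong)
  moreover have "cos (y + (- pi / 2)) = sin y" for y :: real
    by (simp add: cos_diff)
  ultimately show ?thesis by simp
qed

lemma continuous_on_trig_poly:
  assumes "p \<in> trig_poly n"
  shows "continuous_on UNIV p"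
  using assms by induction (auto intro!: continuous_intros continuous_on_product_coordinates)

lemma borel_measurable_trig_poly:
  assumes "p \<in> trig_poly n"
  shows "p \<in> borel_measurable (Pi\<^sub>M {..<n} (\<lambda>_. borel))"
  using assms by induction auto

lemma trig_poly_bounded:
  assumes "p \<in> trig_poly n"
  shows "\<exists>C. \<forall>x. \<bar>p x\<bar> \<le> C"
  using assms
proof induction
  case (cos a b)
  then show ?case by (auto intro!: exI[of _ 1])
next
  case (scale p c)
  then obtain C where "\<And>x. \<bar>p x\<bar> \<le> C" by blast
  then show ?case by (intro exI[of _ "\<bar>c\<bar> * C"]) (simp add: abs_mult mult_left_mono)
next
  case (add p q)
  then obtain C D where "\<And>x. \<bar>p x\<bar> \<le> C" "\<And>x. \<bar>q x\<bar> \<le> D" by blast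
  then show ?case by (intro exI[of _ "C + D"] allI abs_triangle_ineq[THEN order_trans] add_mono)
qed

section \<open>Approximation on a cube by globally bounded trigonometric polynomials\<close>

text \<open>Compactness is Tychonoff's theorem. Coordinates from \<open>n\<close> on are pinned to
  0, so that two distinct points of the set differ in one of the first \<open>n\<close> coordinates
  and can be separated by a trigonometric polynomial in those.\<close>

lemma compact_cube:
  "compact {x :: nat \<Rightarrow> real. \<forall>i. x i \<in> (if i < n then {-R..R} else {0})}"
proof -
  have "compactin (product_topology (\<lambda>_::nat. euclideanreal) UNIV)
      (\<Pi>\<^sub>E i\<in>UNIV. if i < n then {-R..R} else {0})"
    by (subst compactin_PiE) auto
  then show ?thesis
    by (simp add: euclidean_product_topology PiE_UNIV_domain Pi_def)
qed

text \<open>The trigonometric polynomials below are invariant under folding each coordinate to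
  \<open>[-R, R]\<close> by \<open>y \<mapsto> arcsin (sin (c y)) / c\<close> with \<open>c = \<pi> / (2 R)\<close>; hence a bound on the
  cube holds globally.\<close>

lemma trig_poly_approximation:
  fixes f :: "(nat \<Rightarrow> real) \<Rightarrow> real"
  assumes f: "continuous_on UNIV f" and B: "\<And>x. \<bar>f x\<bar> \<le> B" and "0 < R" "0 < e"
  obtains p where "p \<in> trig_poly n" "\<And>x. \<bar>p x\<bar> \<le> B + e"
    "\<And>x. (\<And>i. i < n \<Longrightarrow> \<bar>x i\<bar> \<le> R) \<Longrightarrow> (\<And>i. n \<le> i \<Longrightarrow> x i = 0) \<Longrightarrow> \<bar>f x - p x\<bar> < e"
proof -
  define c where "c = pi / (2 * R)"
  have "c > 0" using \<open>0 < R\<close> by (simp add: c_def)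
  define S where "S = {x :: nat \<Rightarrow> real. \<forall>i. x i \<in> (if i < n then {-R..R} else {0})}"
  define \<theta> :: "(nat \<Rightarrow> real) \<Rightarrow> nat \<Rightarrow> real"
    where "\<theta> x = (\<lambda>i. if i < n then arcsin (sin (c * x i)) / c else 0)" for x
  \<comment> \<open>Invariance under \<open>\<theta>\<close> passes to sums and products, so
    \<open>Q\<close> is still an algebra; it contains the sines below because sin (arcsin (sin y)) =
    sin y.\<close>
  define Q where "Q = {p \<in> trig_poly n. \<forall>x. p (\<theta> x) = p x}"
  have \<theta>_S: "\<theta> x \<in> S" for x
  proof -
    have "\<bar>arcsin (sin y)\<bar> \<le> pi / 2" for y :: real
      using arcsin[of "sin y"] by auto
    then have "\<bar>arcsin (sin y) / c\<bar> \<le> R" for y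
      using \<open>0 < R\<close> by (simp add: c_def field_simps abs_mult)
    then have "- R \<le> arcsin (sin y) / c \<and> arcsin (sin y) / c \<le> R" for y
      unfolding abs_le_iff by (simp add: minus_le_iff)
    then show ?thesis by (auto simp: S_def \<theta>_def)
  qed
  have sin_Q: "(\<lambda>x. sin (c * x i)) \<in> Q" if "i < n" for i
    using that \<open>c > 0\<close> by (simp add: Q_def trig_poly_sin_component \<theta>_def)
  interpret function_ring_on Q S
  proof
    show "compact S" unfolding S_def by (rule compact_cube)
    show "continuous_on S p" if "p \<in> Q" for p
      using that continuous_on_trig_poly[of p n] continuous_on_subset[of UNIV p S] by (auto simp: Q_def)
    show "\<exists>p\<in>Q. p x \<noteq> p y" if "x \<in> S" "y \<in> S" "x \<noteq> y" for x y
    proof -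
      obtain i where i: "x i \<noteq> y i" using \<open>x \<noteq> y\<close> by blast
      have "i < n" using that i by (auto simp: S_def split: if_splits dest!: spec[of _ i])
      then have "\<bar>x i\<bar> \<le> R" "\<bar>y i\<bar> \<le> R"
        using that by (auto simp: S_def abs_le_iff dest!: spec[of _ i])
      \<comment> \<open>The scale \<open>c\<close> sends [-R, R] to [-pi/2, pi/2], where the sine is
        injective; hence one coordinate sine separates \<open>x\<close> from
        \<open>y\<close>.\<close>
      then have "\<bar>c * x i\<bar> \<le> pi / 2" "\<bar>c * y i\<bar> \<le> pi / 2"
        using \<open>0 < R\<close> by (auto simp: c_def abs_mult field_simps)
      then have "- (pi / 2) \<le> c * x i" "c * x i \<le> pi / 2" "- (pi / 2) \<le> c * y i" "c * y i \<le> pi / 2"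
        by linarith+
      then have "sin (c * x i) \<noteq> sin (c * y i)"
        using i \<open>c > 0\<close> sin_inj_pi[of "c * x i" "c * y i"] by (metis mult_cancel_left less_irrefl)
      then show ?thesis by (rule bexI[OF _ sin_Q[OF \<open>i < n\<close>]])
    qed
  qed (simp_all add: Q_def trig_poly.add trig_poly_mult trig_poly_const)
  obtain p where p: "p \<in> Q" "\<And>x. x \<in> S \<Longrightarrow> \<bar>f x - p x\<bar> < e"
    using Stone_Weierstrass_basic[OF continuous_on_subset[OF f subset_UNIV] \<open>0 < e\<close>] by blast
  show ?thesis
  proof
    show "p \<in> trig_poly n" using p by (simp add: Q_def)
    show "\<bar>p x\<bar> \<le> B + e" for x
    proof -
      have "p x = p (\<theta> x)" using p by (simp add: Q_def)
      then show ?thesis using p(2)[OF \<theta>_S, of x] B[of "\<theta> x"] by linarith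
    qed
    show "\<bar>f x - p x\<bar> < e"
      if "\<And>i. i < n \<Longrightarrow> \<bar>x i\<bar> \<le> R" "\<And>i. n \<le> i \<Longrightarrow> x i = 0" for x
      using that by (intro p(2)) (auto simp: S_def abs_le_iff minus_le_iff)
  qed
qed

section \<open>From cosine test functions to bounded continuous test functions\<close>

text \<open>Moves a test function from the extensional functions on \<open>{..<n}\<close> to all
  sequences, where the approximation above lives.\<close>

lemma continuous_on_restrict_lessThan:
  fixes f :: "(nat \<Rightarrow> real) \<Rightarrow> real"
  assumes "continuous_map (product_topology (\<lambda>_. euclideanreal) {..<n}) euclideanreal f"
  shows "continuous_on UNIV (\<lambda>x. f (restrict x {..<n}))"
proof -
  have "continuous_map (product_topology (\<lambda>_. euclideanreal) UNIV)
          (product_topology (\<lambda>_. euclideanreal) {..<n}) (\<lambda>x. restrict x {..<n})"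
    by (auto simp: continuous_map_componentwise intro: continuous_map_product_projection)
  from continuous_map_compose[OF this assms] show ?thesis
    by (simp add: euclidean_product_topology o_def)
qed

text \<open>Lets a point of the product space, which is \<open>undefined\<close> from
  \<open>n\<close> on, be exchanged for its zero-padded copy in the cube.\<close>

lemma trig_poly_cong:
  assumes "p \<in> trig_poly n" "\<And>i. i < n \<Longrightarrow> x i = y i"
  shows "p x = p y"
  using assms by induction auto

lemma tendsto_integral_trig_poly:
  assumes p: "p \<in> trig_poly n"
    and cos: "\<And>a b. ((\<lambda>h. \<integral>x. cos ((\<Sum>i<n. a i * x i) + b) \<partial>\<mu> h) \<longlongrightarrow>
          (\<integral>x. cos ((\<Sum>i<n. a i * x i) + b) \<partial>\<nu>)) F"
    and \<mu>: "\<forall>\<^sub>F h in F. prob_space (\<mu> h)" "\<And>h. sets (\<mu> h) = sets (Pi\<^sub>M {..<n} (\<lambda>_. borel))"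
    and \<nu>: "prob_space \<nu>" "sets \<nu> = sets (Pi\<^sub>M {..<n} (\<lambda>_. borel))"
  shows "((\<lambda>h. \<integral>x. p x \<partial>\<mu> h) \<longlongrightarrow> (\<integral>x. p x \<partial>\<nu>)) F"
proof -
  have int: "integrable P q" if "q \<in> trig_poly n" "prob_space P"
    "sets P = sets (Pi\<^sub>M {..<n} (\<lambda>_. borel))" for P q
  proof -
    interpret prob_space P by fact
    obtain C where "\<And>x. \<bar>q x\<bar> \<le> C" using trig_poly_bounded[OF \<open>q \<in> trig_poly n\<close>] by blast
    then show ?thesis
      using borel_measurable_trig_poly[OF \<open>q \<in> trig_poly n\<close>]
        measurable_cong_sets[OF \<open>sets P = _\<close> refl]
      by (intro integrable_const_bound[of _ C]) auto
  qed
  from p show ?thesis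
  proof induction
    case (cos a b)
    then show ?case by (rule assms(2))
  next
    case (scale p c)
    then show ?case by (auto intro: tendsto_intros)
  next
    case (add p q)
    \<comment> \<open>Splitting the integral of a sum requires integrability, which boundedness
      gives once \<open>\<mu> h\<close> is a probability measure; so the identity holds only
      eventually.\<close>
    have "\<forall>\<^sub>F h in F. (\<integral>x. p x \<partial>\<mu> h) + (\<integral>x. q x \<partial>\<mu> h) = (\<integral>x. p x + q x \<partial>\<mu> h)"
      using \<mu>(1) by eventually_elim
        (simp add: Bochner_Integration.integral_add[OF int[OF add(1)] int[OF add(2)]] \<mu>(2))
    moreover have "(\<integral>x. p x + q x \<partial>\<nu>) = (\<integral>x. p x \<partial>\<nu>) + (\<integral>x. q x \<partial>\<nu>)"
      using add(1,2) \<nu> by (intro Bochner_Integration.integral_add int)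
    ultimately show ?case
      using Lim_transform_eventually[OF tendsto_add[OF add(3,4)]] by simp
  qed
qed

text \<open>Chebyshev's inequality in pointwise form: outside the cube the sum of squares exceeds
  \<open>R\<^sup>2\<close>, so the crude bound \<open>B + D\<close> on the difference is dominated
  by \<open>B + D\<close> times that sum over \<open>R\<^sup>2\<close>. Integrating one inequality
  valid everywhere gives both contributions at once.\<close>

lemma integral_cube_approximation:
  fixes f p :: "(nat \<Rightarrow> real) \<Rightarrow> real"
  assumes "prob_space P" and sets: "sets P = sets (Pi\<^sub>M {..<n} (\<lambda>_. borel))"
    and f: "f \<in> borel_measurable P" "\<And>x. x \<in> space P \<Longrightarrow> \<bar>f x\<bar> \<le> B"
    and p: "p \<in> borel_measurable P" "\<And>x. x \<in> space P \<Longrightarrow> \<bar>p x\<bar> \<le> D"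
    and cube: "\<And>x. x \<in> space P \<Longrightarrow> (\<And>i. i < n \<Longrightarrow> \<bar>x i\<bar> \<le> R) \<Longrightarrow> \<bar>f x - p x\<bar> \<le> e"
    and mom: "\<And>i. i < n \<Longrightarrow> integrable P (\<lambda>x. (x i)\<^sup>2)" "\<And>i. i < n \<Longrightarrow> (\<integral>x. (x i)\<^sup>2 \<partial>P) \<le> C"
    and "0 < R" "0 \<le> e"
  shows "\<bar>(\<integral>x. f x \<partial>P) - (\<integral>x. p x \<partial>P)\<bar> \<le> e + (B + D) * (n * C / R\<^sup>2)"
proof -
  interpret prob_space P by fact
  have int: "integrable P f" "integrable P p"
    using f p by (auto intro!: integrable_const_bound AE_I2)
  obtain x0 where "x0 \<in> space P" using not_empty by blast
  then have BD: "0 \<le> B + D" using f(2) p(2) by fastforce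
  have pt: "\<bar>f x - p x\<bar> \<le> e + (B + D) * ((\<Sum>i<n. (x i)\<^sup>2) / R\<^sup>2)" if x: "x \<in> space P" for x
  proof (cases "\<forall>i<n. \<bar>x i\<bar> \<le> R")
    case True
    have "0 \<le> (B + D) * ((\<Sum>i<n. (x i)\<^sup>2) / R\<^sup>2)"
      using BD by (intro mult_nonneg_nonneg divide_nonneg_nonneg sum_nonneg) auto
    then show ?thesis using cube[OF x] True by fastforce
  next
    case False
    then obtain i where i: "i < n" "R < \<bar>x i\<bar>" by force
    have "R\<^sup>2 \<le> (x i)\<^sup>2" using i \<open>0 < R\<close> by (simp add: abs_le_square_iff[symmetric])
    also have "\<dots> \<le> (\<Sum>i<n. (x i)\<^sup>2)" using i by (intro member_le_sum) auto
    finally have "1 \<le> (\<Sum>i<n. (x i)\<^sup>2) / R\<^sup>2" using \<open>0 < R\<close> by (simp add: field_simps)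
    from mult_left_mono[OF this BD]
    have "B + D \<le> (B + D) * ((\<Sum>i<n. (x i)\<^sup>2) / R\<^sup>2)" by simp
    moreover have "\<bar>f x - p x\<bar> \<le> B + D" using f(2)[OF x] p(2)[OF x] by linarith
    ultimately show ?thesis using \<open>0 \<le> e\<close> by linarith
  qed
  have int_sq: "integrable P (\<lambda>x. (B + D) * ((\<Sum>i<n. (x i)\<^sup>2) / R\<^sup>2))"
    using mom by (intro integrable_mult_right integrable_divide Bochner_Integration.integrable_sum) auto
  have "\<bar>(\<integral>x. f x \<partial>P) - (\<integral>x. p x \<partial>P)\<bar> = \<bar>\<integral>x. f x - p x \<partial>P\<bar>"
    using int by simp
  also have "\<dots> \<le> (\<integral>x. \<bar>f x - p x\<bar> \<partial>P)"
    by (rule integral_abs_bound)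
  also have "\<dots> \<le> (\<integral>x. e + (B + D) * ((\<Sum>i<n. (x i)\<^sup>2) / R\<^sup>2) \<partial>P)"
    using int int_sq pt by (intro integral_mono Bochner_Integration.integrable_add) auto
  also have "\<dots> = e + (B + D) * ((\<Sum>i<n. \<integral>x. (x i)\<^sup>2 \<partial>P) / R\<^sup>2)"
    using int_sq mom by (simp only: Bochner_Integration.integral_add integrable_const
        integral_mult_right_zero integral_divide_zero)
      (simp add: prob_space Bochner_Integration.integral_sum)
  also have "\<dots> \<le> e + (B + D) * (n * C / R\<^sup>2)"
    using mom sum_bounded_above[of "{..<n}" "\<lambda>i. \<integral>x. (x i)\<^sup>2 \<partial>P" C] BD
    by (intro add_left_mono mult_left_mono divide_right_mono) auto
  finally show ?thesis .
qed

text \<open>A continuity theorem in which the common second moment bound \<open>C\<close> supplies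
  tightness: \<open>f\<close> is replaced by a trigonometric polynomial under \<open>\<mu> h\<close>
  and under \<open>\<nu>\<close> with the same small error.\<close>

lemma weakly_convergent_on_if_tendsto_cos:
  fixes n :: nat
  assumes cos: "\<And>a b. ((\<lambda>h. \<integral>x. cos ((\<Sum>i<n. a i * x i) + b) \<partial>\<mu> h) \<longlongrightarrow>
          (\<integral>x. cos ((\<Sum>i<n. a i * x i) + b) \<partial>\<nu>)) F"
    and \<mu>: "\<forall>\<^sub>F h in F. prob_space (\<mu> h)" "\<And>h. sets (\<mu> h) = sets (Pi\<^sub>M {..<n} (\<lambda>_. borel))"
    and \<nu>: "prob_space \<nu>" "sets \<nu> = sets (Pi\<^sub>M {..<n} (\<lambda>_. borel))"
    and mom_\<mu>: "\<forall>\<^sub>F h in F. \<forall>i<n. integrable (\<mu> h) (\<lambda>x. (x i)\<^sup>2) \<and> (\<integral>x. (x i)\<^sup>2 \<partial>\<mu> h) \<le> C"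
    and mom_\<nu>: "\<And>i. i < n \<Longrightarrow> integrable \<nu> (\<lambda>x. (x i)\<^sup>2) \<and> (\<integral>x. (x i)\<^sup>2 \<partial>\<nu>) \<le> C"
  shows "weakly_convergent_on (product_topology (\<lambda>_. euclideanreal) {..<n}) \<mu> \<nu> F"
  unfolding weakly_convergent_on_def
proof (intro allI impI)
  fix f :: "(nat \<Rightarrow> real) \<Rightarrow> real"
  assume cont: "continuous_map (product_topology (\<lambda>_. euclideanreal) {..<n}) euclideanreal f"
    and bdd: "bounded (f ` topspace (product_topology (\<lambda>_. euclideanreal) {..<n}))"
  have sp: "space P = (\<Pi>\<^sub>E i\<in>{..<n}. UNIV)" if "sets P = sets (Pi\<^sub>M {..<n} (\<lambda>_. borel :: real measure))" for P
    using sets_eq_imp_space_eq[OF that] by (simp add: space_PiM)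
  obtain B where B: "\<And>x. x \<in> (\<Pi>\<^sub>E i\<in>{..<n}. UNIV) \<Longrightarrow> \<bar>f x\<bar> \<le> B"
    using bdd by (auto simp: bounded_iff)
  have B0: "0 \<le> B" using B[of "\<lambda>i\<in>{..<n}. 0"] by (auto simp: PiE_def)
  show "((\<lambda>h. \<integral>x. f x \<partial>\<mu> h) \<longlongrightarrow> (\<integral>x. f x \<partial>\<nu>)) F"
  proof (rule tendstoI)
    fix e :: real assume "0 < e"
    \<comment> \<open>The final estimate costs 2d + d + 2d = 5d, which is less than
      \<open>e\<close>. The cap 1 gives \<open>B + (B + d) \<le> 2 * B + 1\<close>.\<close>
    define d where "d = min 1 (e / 6)"
    have d: "0 < d" "d \<le> 1" "d \<le> e / 6" using \<open>0 < e\<close> by (auto simp: d_def)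
    \<comment> \<open>Solves \<open>d * R\<^sup>2 = (2 * B + 1) * (n * \<bar>C\<bar>) + d\<close>,
      which makes the tail term at most \<open>d\<close>. The summand 1 keeps \<open>R\<close>
      positive when \<open>n\<close> or \<open>C\<close> vanishes.\<close>
    define R where "R = sqrt ((2 * B + 1) * (n * \<bar>C\<bar>) / d + 1)"
    have pos: "0 < (2 * B + 1) * (n * \<bar>C\<bar>) / d + 1"
      using d B0 by (intro add_nonneg_pos divide_nonneg_pos mult_nonneg_nonneg) auto
    then have "0 < R" by (simp add: R_def)
    have R2: "R\<^sup>2 = (2 * B + 1) * (n * \<bar>C\<bar>) / d + 1" using pos by (simp add: R_def)
    have tail: "(B + (B + d)) * (n * C / R\<^sup>2) \<le> d"
    proof -
      have "(B + (B + d)) * (n * C) \<le> (B + (B + d)) * (n * \<bar>C\<bar>)"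
        using B0 d by (intro mult_left_mono) auto
      also have "\<dots> \<le> (2 * B + 1) * (n * \<bar>C\<bar>)"
        using d by (intro mult_right_mono) auto
      also have "\<dots> \<le> d * R\<^sup>2" using d by (simp add: R2 field_simps)
      finally show ?thesis using \<open>0 < R\<close> by (simp add: field_simps)
    qed
    define g where "g x = f (restrict x {..<n})" for x
    have g: "continuous_on UNIV g" unfolding g_def by (rule continuous_on_restrict_lessThan[OF cont])
    have gB: "\<bar>g x\<bar> \<le> B" for x unfolding g_def by (rule B) auto
    obtain p where p: "p \<in> trig_poly n" "\<And>x. \<bar>p x\<bar> \<le> B + d"
      "\<And>x. (\<And>i. i < n \<Longrightarrow> \<bar>x i\<bar> \<le> R) \<Longrightarrow> (\<And>i. n \<le> i \<Longrightarrow> x i = 0) \<Longrightarrow> \<bar>g x - p x\<bar> < d"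
      using trig_poly_approximation[OF g gB \<open>0 < R\<close> d(1)] by blast
    have near: "\<bar>(\<integral>x. f x \<partial>P) - (\<integral>x. p x \<partial>P)\<bar> \<le> 2 * d"
      if P: "prob_space P" "sets P = sets (Pi\<^sub>M {..<n} (\<lambda>_. borel))"
        and mom: "\<And>i. i < n \<Longrightarrow> integrable P (\<lambda>x. (x i)\<^sup>2) \<and> (\<integral>x. (x i)\<^sup>2 \<partial>P) \<le> C" for P
    proof -
      have "\<bar>(\<integral>x. f x \<partial>P) - (\<integral>x. p x \<partial>P)\<bar> \<le> d + (B + (B + d)) * (n * C / R\<^sup>2)"
      proof (rule integral_cube_approximation[OF P])
        show "\<bar>f x - p x\<bar> \<le> d" if x: "x \<in> space P" and "\<And>i. i < n \<Longrightarrow> \<bar>x i\<bar> \<le> R" for x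
        proof -
          let ?x = "\<lambda>i. if i < n then x i else 0"
          have "restrict ?x {..<n} = x"
            using x by (auto simp: sp[OF P(2)] PiE_def extensional_def fun_eq_iff)
          then have "g ?x = f x" by (simp add: g_def)
          moreover have "p ?x = p x" by (rule trig_poly_cong[OF p(1)]) simp
          ultimately show ?thesis using p(3)[of ?x] that(2) by fastforce
        qed
        show "f \<in> borel_measurable P" "p \<in> borel_measurable P"
          using borel_measurable_continuous_map_PiM[OF cont] borel_measurable_trig_poly[OF p(1)]
            measurable_cong_sets[OF P(2) refl] by auto
      qed (use p B mom \<open>0 < R\<close> d sp[OF P(2)] in auto)
      with tail show ?thesis by linarith
    qed
    have "((\<lambda>h. \<integral>x. p x \<partial>\<mu> h) \<longlongrightarrow> (\<integral>x. p x \<partial>\<nu>)) F"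
      by (rule tendsto_integral_trig_poly[OF p(1) cos \<mu> \<nu>])
    then have "\<forall>\<^sub>F h in F. dist (\<integral>x. p x \<partial>\<mu> h) (\<integral>x. p x \<partial>\<nu>) < d"
      using d(1) by (rule tendstoD)
    with \<mu>(1) mom_\<mu> show "\<forall>\<^sub>F h in F. dist (\<integral>x. f x \<partial>\<mu> h) (\<integral>x. f x \<partial>\<nu>) < e"
    proof eventually_elim
      case (elim h)
      show ?case
        using near[OF _ \<mu>(2)] near[OF \<nu> mom_\<nu>] elim d \<open>0 < e\<close> by (fastforce simp: dist_real_def)
    qed
  qed
qed

subsection \<open>Gaussian processes\<close>

text \<open>For positive \<open>s\<close> the real and imaginary parts of the characteristic
  function give the means of cos Z and sin Z, and the addition theorem brings in the phase
  \<open>b\<close>. For \<open>s = 0\<close> the law is a point mass, at 0 by centering, and the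
  same formula holds with variance 0.\<close>

lemma gaussian_rv_centered:
  assumes "prob_space M" and Z: "gaussian_rv M Z" and "(\<integral>\<omega>. Z \<omega> \<partial>M) = 0"
  shows "integrable M (\<lambda>\<omega>. (Z \<omega>)\<^sup>2)"
    and "(\<integral>\<omega>. cos (Z \<omega> + b) \<partial>M) = cos b * exp (- (\<integral>\<omega>. (Z \<omega>)\<^sup>2 \<partial>M) / 2)"
proof -
  interpret prob_space M by fact
  obtain m s where Zm[measurable]: "Z \<in> borel_measurable M" and s: "0 \<le> s"
    and D: "distr M borel Z = (if s = 0 then return borel m
           else density lborel (\<lambda>x. ennreal (normal_density m s x)))"
    using Z by (auto simp: gaussian_rv_def)
  have "integrable M (\<lambda>\<omega>. (Z \<omega>)\<^sup>2) \<and>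
    (\<integral>\<omega>. cos (Z \<omega> + b) \<partial>M) = cos b * exp (- (\<integral>\<omega>. (Z \<omega>)\<^sup>2 \<partial>M) / 2)"
  proof (cases "s = 0")
    case True
    have ae: "AE \<omega> in M. Z \<omega> = m"
    proof -
      have "AE x in distr M borel Z. x = m" unfolding D using True by (simp add: AE_return)
      then show ?thesis by (subst (asm) AE_distr_iff) auto
    qed
    have c: "(\<integral>\<omega>. f (Z \<omega>) \<partial>M) = f m" if [measurable]: "f \<in> borel_measurable borel" for f :: "real \<Rightarrow> real"
    proof -
      have "(\<integral>\<omega>. f (Z \<omega>) \<partial>M) = (\<integral>\<omega>. f m \<partial>M)"
        using ae by (intro integral_cong_AE) auto
      then show ?thesis by (simp add: prob_space)
    qed
    have "m = 0" using c[of "\<lambda>x. x"] assms(3) by simp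
    moreover have "integrable M (\<lambda>\<omega>. (Z \<omega>)\<^sup>2)"
      using ae by (subst integrable_cong_AE[where g="\<lambda>_. m\<^sup>2"]) auto
    ultimately show ?thesis
      using c[of "\<lambda>x. cos (x + b)"] c[of "\<lambda>x. x\<^sup>2"] by simp
  next
    case False
    with s have "0 < s" by simp
    have dist: "distributed M lborel Z (normal_density m s)"
      using D False by (simp add: distributed_def cong: distr_cong)
    have "m = 0" using normal_distributed_expectation[OF \<open>0 < s\<close> dist] assms(3) by simp
    have var: "(\<integral>\<omega>. (Z \<omega>)\<^sup>2 \<partial>M) = s\<^sup>2"
      using normal_distributed_variance[OF \<open>0 < s\<close> dist] assms(3) by simp
    have int: "integrable M (\<lambda>\<omega>. (Z \<omega>)\<^sup>2)"
      using distributed_integrable[OF dist, of "\<lambda>x. x\<^sup>2"] integrable_normal_moment[OF \<open>0 < s\<close>, of 0 2]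
      by (simp add: \<open>m = 0\<close>)
    \<comment> \<open>The characteristic function of \<open>Z\<close> at 1 is that of the standard
      normal variable \<open>Z / s\<close> at \<open>s\<close>.\<close>
    have "distributed M lborel (\<lambda>\<omega>. Z \<omega> / s) std_normal_density"
      using dist normal_standard_normal_convert[OF \<open>0 < s\<close>, of Z m] \<open>m = 0\<close> by simp
    then have "distr M borel (\<lambda>\<omega>. Z \<omega> / s) = std_normal_distribution"
      by (simp add: distributed_def cong: distr_cong)
    then have "(CLINT x | distr M borel (\<lambda>\<omega>. Z \<omega> / s). iexp (s * x)) = exp (- (s^2) / 2)"
      by (metis char_def char_std_normal_distribution)
    then have ch: "(CLINT \<omega> | M. iexp (Z \<omega>)) = exp (- (s^2) / 2)"
      using \<open>0 < s\<close> by (simp add: integral_distr)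
    have "integrable M (\<lambda>\<omega>. iexp (Z \<omega>))"
      by (rule integrable_const_bound[of _ 1]) auto
    then have cs: "(\<integral>\<omega>. cos (Z \<omega>) \<partial>M) = exp (- (s^2) / 2)" "(\<integral>\<omega>. sin (Z \<omega>) \<partial>M) = 0"
      using arg_cong[OF ch, of Re] arg_cong[OF ch, of Im]
      by (simp_all add: integral_Re[symmetric] integral_Im[symmetric] Re_exp Im_exp del: integral_Re integral_Im)
    have "(\<integral>\<omega>. cos (Z \<omega> + b) \<partial>M) = (\<integral>\<omega>. cos (Z \<omega>) * cos b \<partial>M) - (\<integral>\<omega>. sin (Z \<omega>) * sin b \<partial>M)"
      unfolding cos_add by (intro Bochner_Integration.integral_diff integrable_mult_left integrable_const_bound[of _ 1]) auto
    also have "\<dots> = cos b * exp (- s\<^sup>2 / 2)" using cs by simp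
    finally show ?thesis using int var by simp
  qed
  then show "integrable M (\<lambda>\<omega>. (Z \<omega>)\<^sup>2)"
    "(\<integral>\<omega>. cos (Z \<omega> + b) \<partial>M) = cos b * exp (- (\<integral>\<omega>. (Z \<omega>)\<^sup>2 \<partial>M) / 2)" by blast+
qed

text \<open>The definition speaks of sums over sets of indices, whereas the family \<open>u\<close>
  may repeat an index; coefficients belonging to the same index are added up first.\<close>

lemma gaussian_rv_linear_combination:
  assumes X: "gaussian_process_on I M X" and "finite J" and u: "\<And>j. j \<in> J \<Longrightarrow> u j \<in> I"
  shows "gaussian_rv M (\<lambda>\<omega>. \<Sum>j\<in>J. a j * X (u j) \<omega>)"
proof -
  have "gaussian_rv M (\<lambda>\<omega>. \<Sum>t\<in>u ` J. (\<Sum>j\<in>{j \<in> J. u j = t}. a j) * X t \<omega>)"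
    using assms by (auto simp: gaussian_process_on_def image_subset_iff)
  also have "(\<lambda>\<omega>. \<Sum>t\<in>u ` J. (\<Sum>j\<in>{j \<in> J. u j = t}. a j) * X t \<omega>) = (\<lambda>\<omega>. \<Sum>j\<in>J. a j * X (u j) \<omega>)"
    using \<open>finite J\<close> by (auto simp: fun_eq_iff sum_distrib_right sum.image_gen[of J _ u] intro!: sum.cong)
  finally show ?thesis .
qed

text \<open>Prescribed values of expectations do not entail integrability, since the integral of a
  non-integrable function is 0 by convention. It is Gaussianity that provides it, and linearity of
  expectation depends on it from here on.\<close>

lemma centered_gaussian_process_on_square_integrable:
  assumes X: "centered_gaussian_process_on I R M X" and "t \<in> I"
  shows "integrable M (\<lambda>\<omega>. (X t \<omega>)\<^sup>2)"
proof (rule gaussian_rv_centered)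
  show "prob_space M" "(\<integral>\<omega>. X t \<omega> \<partial>M) = 0"
    using assms by (auto simp: centered_gaussian_process_on_def gaussian_process_on_def)
  show "gaussian_rv M (X t)"
    using gaussian_rv_linear_combination[of I M X "{t}" "\<lambda>t. t" "\<lambda>_. 1"] assms
    by (simp add: centered_gaussian_process_on_def)
qed

lemma centered_gaussian_process_on_integrable:
  assumes X: "centered_gaussian_process_on I R M X" and "t \<in> I" "s \<in> I"
  shows "integrable M (X t)" and "integrable M (\<lambda>\<omega>. X t \<omega> * X s \<omega>)"
proof -
  interpret prob_space M
    using X by (simp add: centered_gaussian_process_on_def gaussian_process_on_def)
  have [measurable]: "X t \<in> borel_measurable M" "X s \<in> borel_measurable M"
    using assms by (simp_all add: centered_gaussian_process_on_def gaussian_process_on_def)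
  have sq: "integrable M (\<lambda>\<omega>. (X t \<omega>)\<^sup>2)" "integrable M (\<lambda>\<omega>. (X s \<omega>)\<^sup>2)"
    using centered_gaussian_process_on_square_integrable[OF X] assms by auto
  show "integrable M (X t)"
    using square_integrable_imp_integrable[OF _ sq(1)] by simp
  show "integrable M (\<lambda>\<omega>. X t \<omega> * X s \<omega>)"
  proof (rule Bochner_Integration.integrable_bound)
    show "integrable M (\<lambda>\<omega>. (X t \<omega>)\<^sup>2 + (X s \<omega>)\<^sup>2)"
      using sq by simp
    have "norm (x * y) \<le> norm (x\<^sup>2 + y\<^sup>2)" for x y :: real
    proof -
      have "2 * (\<bar>x\<bar> * \<bar>y\<bar>) \<le> x\<^sup>2 + y\<^sup>2"
        using sum_squares_bound[of "\<bar>x\<bar>" "\<bar>y\<bar>"] by simp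
      moreover have "0 \<le> \<bar>x\<bar> * \<bar>y\<bar>" by simp
      ultimately have "\<bar>x\<bar> * \<bar>y\<bar> \<le> x\<^sup>2 + y\<^sup>2" by linarith
      then show ?thesis by (simp add: abs_mult)
    qed
    then show "AE \<omega> in M. norm (X t \<omega> * X s \<omega>) \<le> norm ((X t \<omega>)\<^sup>2 + (X s \<omega>)\<^sup>2)"
      by simp
  qed simp
qed

lemma centered_gaussian_process_on_linear_combination:
  fixes a :: "'j \<Rightarrow> real"
  assumes X: "centered_gaussian_process_on I R M X" and "finite J" and u: "\<And>j. j \<in> J \<Longrightarrow> u j \<in> I"
  defines "Z \<equiv> \<lambda>\<omega>. \<Sum>j\<in>J. a j * X (u j) \<omega>"
  shows "integrable M (\<lambda>\<omega>. (Z \<omega>)\<^sup>2)"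
    and "(\<integral>\<omega>. (Z \<omega>)\<^sup>2 \<partial>M) = (\<Sum>j\<in>J. \<Sum>k\<in>J. a j * a k * R (u j) (u k))"
    and "(\<integral>\<omega>. cos (Z \<omega> + b) \<partial>M) = cos b * exp (- (\<Sum>j\<in>J. \<Sum>k\<in>J. a j * a k * R (u j) (u k)) / 2)"
proof -
  interpret prob_space M
    using X by (simp add: centered_gaussian_process_on_def gaussian_process_on_def)
  have int: "integrable M (X (u j))" if "j \<in> J" for j
    using centered_gaussian_process_on_integrable(1)[OF X u u] that by simp
  have prod: "integrable M (\<lambda>\<omega>. X (u j) \<omega> * X (u k) \<omega>)" if "j \<in> J" "k \<in> J" for j k
    using centered_gaussian_process_on_integrable(2)[OF X u u] that by simp
  have EZ: "expectation Z = 0"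
    using X u int by (simp add: Z_def centered_gaussian_process_on_def)
  have gZ: "gaussian_rv M Z"
    unfolding Z_def using X assms(2) u
    by (intro gaussian_rv_linear_combination) (auto simp: centered_gaussian_process_on_def)
  show "integrable M (\<lambda>\<omega>. (Z \<omega>)\<^sup>2)"
    using gaussian_rv_centered(1)[OF prob_space_axioms gZ EZ] .
  have "(\<integral>\<omega>. (Z \<omega>)\<^sup>2 \<partial>M) = (\<integral>\<omega>. (\<Sum>j\<in>J. \<Sum>k\<in>J. a j * a k * (X (u j) \<omega> * X (u k) \<omega>)) \<partial>M)"
    by (simp add: Z_def power2_eq_square sum_product mult_ac)
  also have "\<dots> = (\<Sum>j\<in>J. \<Sum>k\<in>J. a j * a k * expectation (\<lambda>\<omega>. X (u j) \<omega> * X (u k) \<omega>))"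
    using prod by simp
  also have "\<dots> = (\<Sum>j\<in>J. \<Sum>k\<in>J. a j * a k * R (u j) (u k))"
    using X u by (intro sum.cong) (simp_all add: centered_gaussian_process_on_def)
  finally show *: "(\<integral>\<omega>. (Z \<omega>)\<^sup>2 \<partial>M) = (\<Sum>j\<in>J. \<Sum>k\<in>J. a j * a k * R (u j) (u k))" .
  show "(\<integral>\<omega>. cos (Z \<omega> + b) \<partial>M) = cos b * exp (- (\<Sum>j\<in>J. \<Sum>k\<in>J. a j * a k * R (u j) (u k)) / 2)"
    using gaussian_rv_centered(2)[OF prob_space_axioms gZ EZ, of b] * by simp
qed

section \<open>Scaling and increments of Gaussian processes\<close>

lemma centered_gaussian_process_on_scale:
  assumes X: "centered_gaussian_process_on I R M X"
  shows "centered_gaussian_process_on I (\<lambda>t s. c\<^sup>2 * R t s) M (\<lambda>t \<omega>. c * X t \<omega>)"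
proof -
  have "gaussian_rv M (\<lambda>\<omega>. \<Sum>t\<in>T. a t * (c * X t \<omega>))" if "finite T" "T \<subseteq> I" for T a
  proof -
    have "gaussian_rv M (\<lambda>\<omega>. \<Sum>t\<in>T. (a t * c) * X t \<omega>)"
      using X that by (simp only: centered_gaussian_process_on_def gaussian_process_on_def)
    then show ?thesis by (simp add: mult.assoc)
  qed
  moreover have "(\<integral>\<omega>. (c * X t \<omega>) * (c * X s \<omega>) \<partial>M) = c\<^sup>2 * R t s" if "t \<in> I" "s \<in> I" for t s
  proof -
    have "(\<integral>\<omega>. (c * X t \<omega>) * (c * X s \<omega>) \<partial>M) = (\<integral>\<omega>. c\<^sup>2 * (X t \<omega> * X s \<omega>) \<partial>M)"
      by (simp add: power2_eq_square mult_ac)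
    then show ?thesis using X that by (simp add: centered_gaussian_process_on_def)
  qed
  moreover have "(\<lambda>\<omega>. c * X t \<omega>) \<in> borel_measurable M" if "t \<in> I" for t
    using X that by (auto simp: centered_gaussian_process_on_def gaussian_process_on_def)
  ultimately show ?thesis
    using X by (simp add: centered_gaussian_process_on_def gaussian_process_on_def)
qed

lemma centered_gaussian_process_on_increment:
  fixes X :: "'i::plus \<Rightarrow> 'a \<Rightarrow> real"
  assumes X: "centered_gaussian_process_on I R M X" and I: "h \<in> I" "\<And>t. t \<in> J \<Longrightarrow> h + t \<in> I"
  shows "centered_gaussian_process_on J
    (\<lambda>t s. R (h + t) (h + s) - R (h + t) h - R h (h + s) + R h h) M (\<lambda>t \<omega>. X (h + t) \<omega> - X h \<omega>)"
proof -
  have gp: "gaussian_process_on I M X" and [simp]: "prob_space M"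
    using X by (auto simp: centered_gaussian_process_on_def gaussian_process_on_def)
  have [measurable]: "X t \<in> borel_measurable M" if "t \<in> I" for t
    using gp that by (simp add: gaussian_process_on_def)
  note int = centered_gaussian_process_on_integrable[OF X]
  have "gaussian_rv M (\<lambda>\<omega>. \<Sum>t\<in>T. a t * (X (h + t) \<omega> - X h \<omega>))" if "finite T" "T \<subseteq> J" for T a
  proof -
    \<comment> \<open>A combination of increments is one of the original variables over a doubled
      index set: the flag \<open>True\<close> carries \<open>X (h + t)\<close> with coefficient
      \<open>a t\<close>, the flag \<open>False\<close> carries \<open>X h\<close> with
      \<open>- a t\<close>.\<close>
    have "gaussian_rv M (\<lambda>\<omega>. \<Sum>j\<in>T \<times> UNIV. (if snd j then a (fst j) else - a (fst j)) *
        X (if snd j then h + fst j else h) \<omega>)"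
      using that I by (intro gaussian_rv_linear_combination[OF gp]) auto
    also have "(\<lambda>\<omega>. \<Sum>j\<in>T \<times> UNIV. (if snd j then a (fst j) else - a (fst j)) *
        X (if snd j then h + fst j else h) \<omega>) = (\<lambda>\<omega>. \<Sum>t\<in>T. a t * (X (h + t) \<omega> - X h \<omega>))"
      by (simp add: sum.cartesian_product' UNIV_bool algebra_simps)
    finally show ?thesis .
  qed
  moreover have "(\<integral>\<omega>. X (h + t) \<omega> - X h \<omega> \<partial>M) = 0" if "t \<in> J" for t
    using X int(1) I that by (simp add: centered_gaussian_process_on_def)
  moreover have "(\<integral>\<omega>. (X (h + t) \<omega> - X h \<omega>) * (X (h + s) \<omega> - X h \<omega>) \<partial>M) =
      R (h + t) (h + s) - R (h + t) h - R h (h + s) + R h h" if "t \<in> J" "s \<in> J" for t s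
  proof -
    have "(\<integral>\<omega>. (X (h + t) \<omega> - X h \<omega>) * (X (h + s) \<omega> - X h \<omega>) \<partial>M) =
        (\<integral>\<omega>. X (h + t) \<omega> * X (h + s) \<omega> - X (h + t) \<omega> * X h \<omega> - X h \<omega> * X (h + s) \<omega>
          + X h \<omega> * X h \<omega> \<partial>M)"
      by (simp add: algebra_simps)
    then show ?thesis
      using X int(2) I that by (simp add: centered_gaussian_process_on_def)
  qed
  ultimately show ?thesis
    using I by (simp add: centered_gaussian_process_on_def gaussian_process_on_def)
qed

section \<open>Finite-dimensional laws and their convergence\<close>

lemma measurable_restrict_process:
  assumes "gaussian_process_on I M X" "\<And>i. i < n \<Longrightarrow> t i \<in> I"
  shows "(\<lambda>\<omega>. \<lambda>i\<in>{..<n}. X (t i) \<omega>) \<in> M \<rightarrow>\<^sub>M Pi\<^sub>M {..<n} (\<lambda>_. borel)"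
  using assms by (intro measurable_restrict) (simp add: gaussian_process_on_def)

lemma integral_fin_dim_distr:
  fixes g :: "(nat \<Rightarrow> real) \<Rightarrow> real"
  assumes "gaussian_process_on I M X" "\<And>i. i < n \<Longrightarrow> t i \<in> I"
    and "g \<in> borel_measurable (Pi\<^sub>M {..<n} (\<lambda>_. borel))"
  shows "(\<integral>x. g x \<partial>fin_dim_distr M X n t) = (\<integral>\<omega>. g (\<lambda>i\<in>{..<n}. X (t i) \<omega>) \<partial>M)"
    and "integrable (fin_dim_distr M X n t) g \<longleftrightarrow> integrable M (\<lambda>\<omega>. g (\<lambda>i\<in>{..<n}. X (t i) \<omega>))"
proof -
  have m: "(\<lambda>\<omega>. \<lambda>i\<in>{..<n}. X (t i) \<omega>) \<in> M \<rightarrow>\<^sub>M Pi\<^sub>M {..<n} (\<lambda>_. borel)"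
    by (rule measurable_restrict_process[OF assms(1,2)])
  show "(\<integral>x. g x \<partial>fin_dim_distr M X n t) = (\<integral>\<omega>. g (\<lambda>i\<in>{..<n}. X (t i) \<omega>) \<partial>M)"
    unfolding fin_dim_distr_def by (rule integral_distr[OF m assms(3)])
  show "integrable (fin_dim_distr M X n t) g \<longleftrightarrow> integrable M (\<lambda>\<omega>. g (\<lambda>i\<in>{..<n}. X (t i) \<omega>))"
    unfolding fin_dim_distr_def by (rule integrable_distr_eq[OF m assms(3)])
qed

lemma prob_space_fin_dim_distr:
  assumes "gaussian_process_on I M X" "\<And>i. i < n \<Longrightarrow> t i \<in> I"
  shows "prob_space (fin_dim_distr M X n t)"
  unfolding fin_dim_distr_def using assms
  by (intro prob_space.prob_space_distr measurable_restrict_process[OF assms])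
    (simp add: gaussian_process_on_def)

lemma integral_cos_fin_dim_distr:
  assumes X: "centered_gaussian_process_on I R M X" and t: "\<And>i. i < n \<Longrightarrow> t i \<in> I"
  shows "(\<integral>x. cos ((\<Sum>i<n. a i * x i) + b) \<partial>fin_dim_distr M X n t) =
    cos b * exp (- (\<Sum>i<n. \<Sum>j<n. a i * a j * R (t i) (t j)) / 2)"
proof -
  have gp: "gaussian_process_on I M X" using X by (simp add: centered_gaussian_process_on_def)
  have "(\<integral>x. cos ((\<Sum>i<n. a i * x i) + b) \<partial>fin_dim_distr M X n t) =
      (\<integral>\<omega>. cos ((\<Sum>i<n. a i * X (t i) \<omega>) + b) \<partial>M)"
    using t by (subst integral_fin_dim_distr[OF gp]) auto
  also have "\<dots> = cos b * exp (- (\<Sum>i<n. \<Sum>j<n. a i * a j * R (t i) (t j)) / 2)"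
    using t by (intro centered_gaussian_process_on_linear_combination(3)[OF X]) auto
  finally show ?thesis .
qed

lemma second_moment_fin_dim_distr:
  assumes X: "centered_gaussian_process_on I R M X" and t: "\<And>i. i < n \<Longrightarrow> t i \<in> I" and "i < n"
  shows "integrable (fin_dim_distr M X n t) (\<lambda>x. (x i)\<^sup>2)"
    and "(\<integral>x. (x i)\<^sup>2 \<partial>fin_dim_distr M X n t) = R (t i) (t i)"
proof -
  have gp: "gaussian_process_on I M X" using X by (simp add: centered_gaussian_process_on_def)
  have [measurable]: "(\<lambda>x. (x i)\<^sup>2) \<in> borel_measurable (Pi\<^sub>M {..<n} (\<lambda>_. borel :: real measure))"
    using \<open>i < n\<close> by simp
  show "integrable (fin_dim_distr M X n t) (\<lambda>x. (x i)\<^sup>2)"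
    using centered_gaussian_process_on_square_integrable[OF X t[OF \<open>i < n\<close>]] \<open>i < n\<close> t
    by (subst integral_fin_dim_distr(2)[OF gp]) auto
  have "(\<integral>\<omega>. (X (t i) \<omega>)\<^sup>2 \<partial>M) = R (t i) (t i)"
    using X t[OF \<open>i < n\<close>] by (simp add: centered_gaussian_process_on_def power2_eq_square)
  then show "(\<integral>x. (x i)\<^sup>2 \<partial>fin_dim_distr M X n t) = R (t i) (t i)"
    using \<open>i < n\<close> t by (subst integral_fin_dim_distr(1)[OF gp]) auto
qed

text \<open>Covariances do double duty: their quadratic forms determine the cosine expectations, and
  their diagonal entries are the second moments that have to stay bounded. The hypothesis on
  \<open>X\<close> is only eventual because an increment process started at a negative
  \<open>h\<close> would leave the index set.\<close>

lemma fdd_convergent_on_centered_gaussian: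
  fixes X :: "'h \<Rightarrow> 'i \<Rightarrow> 'a \<Rightarrow> real"
  assumes X: "\<forall>\<^sub>F h in F. centered_gaussian_process_on I (R h) M (X h)"
    and Y: "centered_gaussian_process_on I S N Y"
    and R: "\<And>t s. t \<in> I \<Longrightarrow> s \<in> I \<Longrightarrow> ((\<lambda>h. R h t s) \<longlongrightarrow> S t s) F"
  shows "fdd_convergent_on I M X N Y F"
  unfolding fdd_convergent_on_def
proof (intro allI impI)
  fix n and t :: "nat \<Rightarrow> 'i"
  assume "\<forall>i<n. t i \<in> I"
  then have t: "\<And>i. i < n \<Longrightarrow> t i \<in> I" by blast
  \<comment> \<open>A sum of nonnegative terms serves as an upper bound for each of them, also for
    \<open>n = 0\<close>; the added 1 leaves room for the variances before the limit.\<close>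
  define C where "C = (\<Sum>i<n. \<bar>S (t i) (t i)\<bar> + 1)"
  have C: "S (t i) (t i) + 1 \<le> C" if "i < n" for i
  proof -
    have "\<bar>S (t i) (t i)\<bar> + 1 \<le> C"
      unfolding C_def using that by (intro member_le_sum) auto
    then show ?thesis by linarith
  qed
  show "weakly_convergent_on (product_topology (\<lambda>_. euclideanreal) {..<n})
      (\<lambda>h. fin_dim_distr M (X h) n t) (fin_dim_distr N Y n t) F"
  proof (rule weakly_convergent_on_if_tendsto_cos)
    fix a b
    have "((\<lambda>h. cos b * exp (- (\<Sum>i<n. \<Sum>j<n. a i * a j * R h (t i) (t j)) / 2)) \<longlongrightarrow>
        cos b * exp (- (\<Sum>i<n. \<Sum>j<n. a i * a j * S (t i) (t j)) / 2)) F"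
      using t by (intro tendsto_intros R) auto
    moreover have "\<forall>\<^sub>F h in F. cos b * exp (- (\<Sum>i<n. \<Sum>j<n. a i * a j * R h (t i) (t j)) / 2) =
        (\<integral>x. cos ((\<Sum>i<n. a i * x i) + b) \<partial>fin_dim_distr M (X h) n t)"
      using X by eventually_elim (simp add: integral_cos_fin_dim_distr t)
    ultimately show "((\<lambda>h. \<integral>x. cos ((\<Sum>i<n. a i * x i) + b) \<partial>fin_dim_distr M (X h) n t) \<longlongrightarrow>
        (\<integral>x. cos ((\<Sum>i<n. a i * x i) + b) \<partial>fin_dim_distr N Y n t)) F"
      by (subst integral_cos_fin_dim_distr[OF Y]) (erule t, rule Lim_transform_eventually)
  next
    show "\<forall>\<^sub>F h in F. prob_space (fin_dim_distr M (X h) n t)"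
      using X by eventually_elim
        (auto simp: centered_gaussian_process_on_def intro: prob_space_fin_dim_distr t)
    show "prob_space (fin_dim_distr N Y n t)"
      using Y by (auto simp: centered_gaussian_process_on_def intro: prob_space_fin_dim_distr t)
  next
    have "\<forall>\<^sub>F h in F. R h (t i) (t i) < S (t i) (t i) + 1" if "i < n" for i
      using R[OF t t, OF that that] by (rule order_tendstoD) simp
    then have "\<forall>\<^sub>F h in F. \<forall>i\<in>{..<n}. R h (t i) (t i) < S (t i) (t i) + 1"
      by (intro eventually_ball_finite) auto
    with X show "\<forall>\<^sub>F h in F. \<forall>i<n. integrable (fin_dim_distr M (X h) n t) (\<lambda>x. (x i)\<^sup>2) \<and>
        (\<integral>x. (x i)\<^sup>2 \<partial>fin_dim_distr M (X h) n t) \<le> C"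
    proof eventually_elim
      case (elim h)
      have "integrable (fin_dim_distr M (X h) n t) (\<lambda>x. (x i)\<^sup>2) \<and>
          (\<integral>x. (x i)\<^sup>2 \<partial>fin_dim_distr M (X h) n t) \<le> C" if "i < n" for i
      proof -
        have "R h (t i) (t i) \<le> C" using elim(2) that C[OF that] by force
        then show ?thesis
          using second_moment_fin_dim_distr[where n = n and t = t, OF elim(1) _ that] t by simp
      qed
      then show ?case by blast
    qed
    show "integrable (fin_dim_distr N Y n t) (\<lambda>x. (x i)\<^sup>2) \<and>
        (\<integral>x. (x i)\<^sup>2 \<partial>fin_dim_distr N Y n t) \<le> C" if "i < n" for i
      using second_moment_fin_dim_distr[where n = n and t = t, OF Y _ that] t C[OF that] by simp
  qed (simp_all add: fin_dim_distr_def)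
qed

subsection \<open>Covariance of the increments\<close>

lemma DERIV_powr_sum:
  fixes p K x c :: real
  assumes "0 < x" "0 \<le> c"
  shows "((\<lambda>x. (x powr p + c) powr K) has_real_derivative
     K * p * x powr (p - 1) * (x powr p + c) powr (K - 1)) (at x)"
proof -
  have "0 < x powr p + c" using assms by (simp add: add_pos_nonneg)
  moreover have "((\<lambda>x. x powr p + c) has_real_derivative p * x powr (p - 1)) (at x)"
    using DERIV_add[OF has_real_derivative_powr[OF \<open>0 < x\<close>] DERIV_const] by simp
  ultimately show ?thesis
    using DERIV_fun_powr[of "\<lambda>x. x powr p + c" "p * x powr (p - 1)" x K] by (simp add: mult_ac)
qed

text \<open>The mean value theorem with a possibly degenerate interval: the weak inequalities admit
  \<open>x = h\<close> when \<open>t = 0\<close>, so indices equal to 0 need no separate treatment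
  later.\<close>

lemma mean_value_increment:
  fixes f :: "real \<Rightarrow> real"
  assumes "0 \<le> t" and "\<And>x. h \<le> x \<Longrightarrow> x \<le> h + t \<Longrightarrow> (f has_real_derivative f' x) (at x)"
  shows "\<exists>x\<ge>h. x \<le> h + t \<and> f (h + t) - f h = t * f' x"
proof (cases "t = 0")
  case False
  then have "h < h + t" using assms by simp
  have "\<exists>x>h. x < h + t \<and> f (h + t) - f h = (h + t - h) * f' x"
    by (rule MVT2[OF \<open>h < h + t\<close> assms(2)])
  then obtain x where "h < x" "x < h + t" "f (h + t) - f h = (h + t - h) * f' x" by blast
  then show ?thesis by (intro exI[of _ x]) simp
qed auto

text \<open>The mixed derivative of (x^p + y^p)^K is K (K-1) p^2 (x y)^(p-1) (x^p + y^p)^(K-2),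
  homogeneous of degree pK - 2 < 0. On a rectangle of fixed sides \<open>t\<close>, \<open>s\<close>
  at (h, h) it is therefore of order h^(pK-2).\<close>

lemma mixed_difference_powr_sum_tendsto_0:
  fixes p K t s :: real
  assumes "0 \<le> t" "0 \<le> s" "0 < p" "0 < K" "p * K < 2"
  shows "((\<lambda>h. ((h + t) powr p + (h + s) powr p) powr K - ((h + t) powr p + h powr p) powr K
     - ((h + s) powr p + h powr p) powr K + (2 * h powr p) powr K) \<longlongrightarrow> 0) at_top"
proof -
  define G where "G x y = (x powr p + y powr p) powr K" for x y :: real
  \<comment> \<open>For h at least \<open>T\<close> the rectangle lies in [h, 2h] x [h, 2h]. In
    \<open>C\<close> below, the first factor comes from the mixed derivative, the second from x^p +
    y^p being at most 2 (2h)^p, the third is the area of the rectangle.\<close>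
  define T where "T = t + s"
  define C where "C = \<bar>K * (K - 1) * p\<^sup>2\<bar> * (2 * 2 powr p) powr K * (t * s)"
  have bound: "\<bar>G (h + t) (h + s) - G (h + t) h - G (h + s) h + G h h\<bar> \<le> C * h powr (p * K - 2)"
    if h: "0 < h" "T \<le> h" for h
  proof -
    have sym: "G x y = G y x" for x y by (simp add: G_def add.commute)
    \<comment> \<open>The mean value theorem is applied to the difference of two slices, x |-> G(x,
      h+s) - G(x, h), so that one common \<open>x\<close> serves both; the second application then
      varies \<open>y\<close> in the derivative with this \<open>x\<close> fixed.\<close>
    have "\<exists>x\<ge>h. x \<le> h + t \<and> G (h + t) (h + s) - G (h + t) h - (G h (h + s) - G h h) =
       t * (K * p * x powr (p - 1) * (x powr p + (h + s) powr p) powr (K - 1)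
          - K * p * x powr (p - 1) * (x powr p + h powr p) powr (K - 1))"
      unfolding G_def using h \<open>0 \<le> t\<close>
      by (intro mean_value_increment[where f = "\<lambda>x. (x powr p + (h + s) powr p) powr K -
        (x powr p + h powr p) powr K"] DERIV_diff DERIV_powr_sum) auto
    then obtain x where x: "h \<le> x" "x \<le> h + t"
      and 1: "G (h + t) (h + s) - G (h + t) h - (G h (h + s) - G h h) =
       t * (K * p * x powr (p - 1) * (x powr p + (h + s) powr p) powr (K - 1)
          - K * p * x powr (p - 1) * (x powr p + h powr p) powr (K - 1))" by blast
    have "\<exists>y\<ge>h. y \<le> h + s \<and>
       ((h + s) powr p + x powr p) powr (K - 1) - (h powr p + x powr p) powr (K - 1) =
       s * ((K - 1) * p * y powr (p - 1) * (y powr p + x powr p) powr (K - 1 - 1))"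
      using h \<open>0 \<le> s\<close>
      by (intro mean_value_increment[where f = "\<lambda>y. (y powr p + x powr p) powr (K - 1)"]
        DERIV_powr_sum) auto
    then obtain y where y: "h \<le> y" "y \<le> h + s"
      and 2: "((h + s) powr p + x powr p) powr (K - 1) - (h powr p + x powr p) powr (K - 1) =
       s * ((K - 1) * p * y powr (p - 1) * (y powr p + x powr p) powr (K - 1 - 1))" by blast
    define z where "z = x powr p + y powr p"
    have pos: "0 < x" "0 < y" "0 < z" using h x y by (auto simp: z_def add_pos_pos)
    have E: "G (h + t) (h + s) - G (h + t) h - (G h (h + s) - G h h) =
       K * (K - 1) * p\<^sup>2 * (t * s) * (x powr (p - 1) * y powr (p - 1) * z powr (K - 2))"
    proof -
      have "G (h + t) (h + s) - G (h + t) h - (G h (h + s) - G h h) = t * (K * p * x powr (p - 1) *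
        (((h + s) powr p + x powr p) powr (K - 1) - (h powr p + x powr p) powr (K - 1)))"
        unfolding 1 by (simp add: right_diff_distrib add.commute)
      then show ?thesis unfolding 2 by (simp add: z_def power2_eq_square add.commute)
    qed
    \<comment> \<open>\<open>x powr (p - 1) \<le> z / h\<close> and the same for \<open>y\<close>, whatever the sign of \<open>p - 1\<close>\<close>
    have "x powr (p - 1) \<le> z / h" "y powr (p - 1) \<le> z / h"
      using h x y pos by (auto simp: powr_diff z_def intro!: frac_le)
    \<comment> \<open>The two factors \<open>z / h\<close> raise the negative exponent
      \<open>K - 2\<close> to the positive \<open>K\<close>, after which an upper bound on
      \<open>z\<close> is enough.\<close>
    then have "x powr (p - 1) * y powr (p - 1) * z powr (K - 2) \<le> z / h * (z / h) * z powr (K - 2)"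
      using h pos by (intro mult_mono) auto
    also have "\<dots> = z powr K / h\<^sup>2"
      using pos by (simp add: powr_diff power2_eq_square)
    also have "\<dots> \<le> (2 * 2 powr p) powr K * h powr (p * K) / h\<^sup>2"
    proof -
      have "x powr p \<le> (2 * h) powr p" "y powr p \<le> (2 * h) powr p"
        using assms h x y T_def by (auto intro!: powr_mono2)
      then have "z \<le> 2 * 2 powr p * h powr p"
        using h by (simp add: z_def powr_mult)
      then have "z powr K \<le> (2 * 2 powr p * h powr p) powr K"
        using pos assms by (intro powr_mono2) auto
      also have "\<dots> = (2 * 2 powr p) powr K * h powr (p * K)"
        using h by (simp add: powr_mult powr_powr)
      finally show ?thesis by (simp add: divide_right_mono)
    qed
    also have "\<dots> = (2 * 2 powr p) powr K * h powr (p * K - 2)"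
      using h by (simp add: powr_diff)
    finally have b: "x powr (p - 1) * y powr (p - 1) * z powr (K - 2)
      \<le> (2 * 2 powr p) powr K * h powr (p * K - 2)" .
    have "\<bar>G (h + t) (h + s) - G (h + t) h - (G h (h + s) - G h h)\<bar> =
       \<bar>K * (K - 1) * p\<^sup>2\<bar> * (t * s) * (x powr (p - 1) * y powr (p - 1) * z powr (K - 2))"
      using assms pos unfolding E abs_mult by simp
    also have "\<dots> \<le> \<bar>K * (K - 1) * p\<^sup>2\<bar> * (t * s) * ((2 * 2 powr p) powr K * h powr (p * K - 2))"
      using assms by (intro mult_left_mono[OF b]) auto
    finally show ?thesis by (simp add: C_def sym[of h "h + s"] algebra_simps)
  qed
  have "((\<lambda>h. C * h powr (p * K - 2)) \<longlongrightarrow> C * 0) at_top"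
    using assms by (intro tendsto_intros tendsto_neg_powr filterlim_ident) auto
  moreover have "\<forall>\<^sub>F h in at_top. norm (G (h + t) (h + s) - G (h + t) h - G (h + s) h + G h h)
      \<le> C * h powr (p * K - 2)"
    using eventually_gt_at_top[of 0] eventually_ge_at_top[of T]
    by eventually_elim (simp add: bound)
  ultimately have "((\<lambda>h. G (h + t) (h + s) - G (h + t) h - G (h + s) h + G h h) \<longlongrightarrow> 0) at_top"
    unfolding mult_zero_right by (rule Lim_null_comparison[rotated])
  then show ?thesis by (simp only: G_def mult_2)
qed

theorem theorem2p1:
  fixes H K :: real
    and M :: "'a measure" and B :: "real \<Rightarrow> 'a \<Rightarrow> real"
    and N :: "'b measure" and W :: "real \<Rightarrow> 'b \<Rightarrow> real"
  assumes "0 < H" and "H < 1" and "0 < K" and "K < 1"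
    and "bifractional_brownian_motion H K M B"
    and "fractional_brownian_motion (H * K) N W"
  shows "fdd_convergent_on {0..} M (\<lambda>h t \<omega>. B (h + t) \<omega> - B h \<omega>)
           N (\<lambda>t \<omega>. 2 powr ((1 - K) / 2) * W t \<omega>) at_top"
proof -
  define R where "R t s = 2 powr (-K) *
    ((t powr (2 * H) + s powr (2 * H)) powr K - \<bar>t - s\<bar> powr (2 * H * K))" for t s :: real
  have B: "centered_gaussian_process_on {0..} R M B"
    using assms(5) by (simp add: bifractional_brownian_motion_def R_def[abs_def])
  let ?D = "\<lambda>h t s :: real. R (h + t) (h + s) - R (h + t) h - R h (h + s) + R h h"
  let ?S = "\<lambda>t s :: real. (2 powr ((1 - K) / 2))\<^sup>2 *
    (1 / 2 * (t powr (2 * (H * K)) + s powr (2 * (H * K)) - \<bar>t - s\<bar> powr (2 * (H * K))))"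
  show ?thesis
  proof (rule fdd_convergent_on_centered_gaussian)
    show "\<forall>\<^sub>F h in at_top. centered_gaussian_process_on {0..} (?D h) M (\<lambda>t \<omega>. B (h + t) \<omega> - B h \<omega>)"
      \<comment> \<open>Nonnegative \<open>h\<close> keeps \<open>h\<close> and \<open>h + t\<close>
        in the index set.\<close>
      using eventually_ge_at_top[of "0::real"]
      by eventually_elim (intro centered_gaussian_process_on_increment[OF B]; simp)
    show "centered_gaussian_process_on {0..} ?S N (\<lambda>t \<omega>. 2 powr ((1 - K) / 2) * W t \<omega>)"
      using centered_gaussian_process_on_scale[OF assms(6)[unfolded fractional_brownian_motion_def]] .
  next
    fix t s :: real assume "t \<in> {0..}" "s \<in> {0..}"
    then have ts: "0 \<le> t" "0 \<le> s" by auto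
    \<comment> \<open>The part of the increment covariance coming from sums of powers, without the
      factor 2^(-K); the |t - s| parts do not depend on \<open>h\<close> and produce the
      limit.\<close>
    define L where "L h = ((h + t) powr (2 * H) + (h + s) powr (2 * H)) powr K
      - ((h + t) powr (2 * H) + h powr (2 * H)) powr K
      - ((h + s) powr (2 * H) + h powr (2 * H)) powr K + (2 * h powr (2 * H)) powr K" for h
    have "H * K < 1" using mult_strict_mono[of H 1 K 1] assms by simp
    then have "(L \<longlongrightarrow> 0) at_top"
      unfolding L_def using ts assms by (intro mixed_difference_powr_sum_tendsto_0) auto
    then have "((\<lambda>h. 2 powr (-K) * (L h + (t powr (2 * H * K) + s powr (2 * H * K) - \<bar>t - s\<bar> powr (2 * H * K))))
      \<longlongrightarrow> 2 powr (-K) * (0 + (t powr (2 * H * K) + s powr (2 * H * K) - \<bar>t - s\<bar> powr (2 * H * K)))) at_top"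
      by (intro tendsto_intros)
    moreover have "2 powr (-K) * (L h + (t powr (2 * H * K) + s powr (2 * H * K) - \<bar>t - s\<bar> powr (2 * H * K)))
        = ?D h t s" for h
      using ts by (simp add: L_def R_def add.commute[of "h powr (2 * H)"] algebra_simps)
    moreover have "2 powr (-K) * (0 + (t powr (2 * H * K) + s powr (2 * H * K) - \<bar>t - s\<bar> powr (2 * H * K)))
        = ?S t s"
    proof -
      \<comment> \<open>The squared scale is 2 times 2^(-K), and this 2 cancels the 1/2 in the
        fractional Brownian covariance.\<close>
      have "(2 powr ((1 - K) / 2))\<^sup>2 = (2::real) powr (1 - K)"
        by (simp add: power2_eq_square powr_add[symmetric])
      also have "\<dots> = 2 * 2 powr (-K)" by (simp add: powr_diff powr_minus_divide)
      finally show ?thesis by (simp add: mult.assoc)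
    qed
    ultimately show "((\<lambda>h. ?D h t s) \<longlongrightarrow> ?S t s) at_top" by (simp only:)
  qed
qed

end
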